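(* Let $a,b,p,q$ be integers with $p^2+4q\neq 0$, let $(w_n)_{n\ge 0}$ be the Horadam sequence $w_0=a$, $w_1=b$, $w_n=pw_{n-1}+qw_{n-2}$ for $n\ge 2$, and let $\mathbb{O}G_n=w_ne_0+w_{n+1}e_1+\dots+w_{n+7}e_7$ be the $n$-th Horadam octonion. Put $\alpha=\frac{p+\sqrt{p^2+4q}}{2}$, $\beta=\frac{p-\sqrt{p^2+4q}}{2}$, $A=b-a\beta$ and $B=b-a\alpha$. Then for every integer $n\ge 0$, $$Nr(\mathbb{O}G_n)=\frac{A^2\alpha^{2n}(1+\alpha^2+\alpha^4+\dots+\alpha^{14})+B^2\beta^{2n}(1+\beta^2+\beta^4+\dots+\beta^{14})}{(\alpha-\beta)^2}-L,$$ where $$L=\frac{2AB(-q)^n\left(1+(-q)+(-q)^2+\dots+(-q)^7\right)}{(\alpha-\beta)^2}.$$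
   Context: $\mathbb{O}$ is the eight-dimensional real octonion algebra with standard basis $e_0=1,e_1,\dots,e_7$. For $x=\sum_{i=0}^7k_ie_i$ with $k_i\in\mathbb{R}$, the conjugate is $\overline{x}=k_0-\sum_{i=1}^7k_ie_i$ and the norm is $Nr(x)=\overline{x}\circ x=x\circ\overline{x}=k_0^2+k_1^2+\dots+k_7^2$, where $\circ$ is octonion multiplication. If $p^2+4q<0$, then $\sqrt{p^2+4q}$ denotes a fixed complex square root and the identity is one of complex numbers. The convention $0^0=1$ is used. *)

theory Defs
  imports "HOL-Analysis.Analysis"
begin

text \<open>
  The constructor lists the coordinates \<open>k\<^sub>0, \<dots>, k\<^sub>7\<close> of an octonion with respect to the
  standard basis \<open>e\<^sub>0 = 1, e\<^sub>1, \<dots>, e\<^sub>7\<close>. Octonion multiplication is not associative, so the type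
  cannot be an instance of the ring or real-algebra classes; a real number \<open>r\<close> is identified with
  the octonion \<open>r *\<^sub>R 1\<close>.
\<close>

datatype octonion = Octonion
  (o0: real) (o1: real) (o2: real) (o3: real) (o4: real) (o5: real) (o6: real) (o7: real)

lemma octonion_eq_iff:
  "x = y \<longleftrightarrow> o0 x = o0 y \<and> o1 x = o1 y \<and> o2 x = o2 y \<and> o3 x = o3 y \<and>
             o4 x = o4 y \<and> o5 x = o5 y \<and> o6 x = o6 y \<and> o7 x = o7 y"
  by (cases x; cases y) simp

instantiation octonion :: real_vector
begin

definition "0 = Octonion 0 0 0 0 0 0 0 0"

definition "x + y = Octonion (o0 x + o0 y) (o1 x + o1 y) (o2 x + o2 y) (o3 x + o3 y)
                             (o4 x + o4 y) (o5 x + o5 y) (o6 x + o6 y) (o7 x + o7 y)"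

definition "- x = Octonion (- o0 x) (- o1 x) (- o2 x) (- o3 x) (- o4 x) (- o5 x) (- o6 x) (- o7 x)"

definition "x - y = Octonion (o0 x - o0 y) (o1 x - o1 y) (o2 x - o2 y) (o3 x - o3 y)
                             (o4 x - o4 y) (o5 x - o5 y) (o6 x - o6 y) (o7 x - o7 y)"

definition "r *\<^sub>R x = Octonion (r * o0 x) (r * o1 x) (r * o2 x) (r * o3 x)
                             (r * o4 x) (r * o5 x) (r * o6 x) (r * o7 x)"

instance
  by standard
    (simp_all add: octonion_eq_iff zero_octonion_def plus_octonion_def uminus_octonion_def
       minus_octonion_def scaleR_octonion_def algebra_simps)

end

text \<open>
  The multiplication is that of the Cayley--Dickson double of the quaternions
  \<open>e\<^sub>0 = 1, e\<^sub>1 = i, e\<^sub>2 = j, e\<^sub>3 = k\<close>, i.e. \<open>(a, b) \<circ> (c, d) = (a c - d\<^sup>* b, d a + b c\<^sup>*)\<close>,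
  where \<open>e\<^sub>4 = (0, 1)\<close>, \<open>e\<^sub>5 = e\<^sub>1 \<circ> e\<^sub>4\<close>, \<open>e\<^sub>6 = e\<^sub>2 \<circ> e\<^sub>4\<close>, \<open>e\<^sub>7 = e\<^sub>3 \<circ> e\<^sub>4\<close>. See
  \<open>octonion_basis_mult\<close> and \<open>octonion_norm_mult\<close> below.
\<close>

instantiation octonion :: "{one, times}"
begin

definition "1 = Octonion 1 0 0 0 0 0 0 0"

definition "x * y = Octonion
  (o0 x * o0 y - o1 x * o1 y - o2 x * o2 y - o3 x * o3 y
     - o4 x * o4 y - o5 x * o5 y - o6 x * o6 y - o7 x * o7 y)
  (o0 x * o1 y + o1 x * o0 y + o2 x * o3 y - o3 x * o2 y
     + o4 x * o5 y - o5 x * o4 y - o6 x * o7 y + o7 x * o6 y)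
  (o0 x * o2 y - o1 x * o3 y + o2 x * o0 y + o3 x * o1 y
     + o4 x * o6 y + o5 x * o7 y - o6 x * o4 y - o7 x * o5 y)
  (o0 x * o3 y + o1 x * o2 y - o2 x * o1 y + o3 x * o0 y
     + o4 x * o7 y - o5 x * o6 y + o6 x * o5 y - o7 x * o4 y)
  (o0 x * o4 y - o1 x * o5 y - o2 x * o6 y - o3 x * o7 y
     + o4 x * o0 y + o5 x * o1 y + o6 x * o2 y + o7 x * o3 y)
  (o0 x * o5 y + o1 x * o4 y - o2 x * o7 y + o3 x * o6 y
     - o4 x * o1 y + o5 x * o0 y - o6 x * o3 y + o7 x * o2 y)
  (o0 x * o6 y + o1 x * o7 y + o2 x * o4 y - o3 x * o5 y
     - o4 x * o2 y + o5 x * o3 y + o6 x * o0 y - o7 x * o1 y)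
  (o0 x * o7 y - o1 x * o6 y + o2 x * o5 y + o3 x * o4 y
     - o4 x * o3 y - o5 x * o2 y + o6 x * o1 y + o7 x * o0 y)"

instance ..

end

definition octonion_basis :: "nat \<Rightarrow> octonion" where
  "octonion_basis i = Octonion (of_bool (i = 0)) (of_bool (i = 1)) (of_bool (i = 2)) (of_bool (i = 3))
                               (of_bool (i = 4)) (of_bool (i = 5)) (of_bool (i = 6)) (of_bool (i = 7))"

definition octonion_cnj :: "octonion \<Rightarrow> octonion" where
  "octonion_cnj x = Octonion (o0 x) (- o1 x) (- o2 x) (- o3 x) (- o4 x) (- o5 x) (- o6 x) (- o7 x)"

text \<open>
  The product of an octonion with its conjugate is real (\<open>octonion_norm_left\<close>); the norm is that
  real number.
\<close>

definition octonion_norm :: "octonion \<Rightarrow> real" where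
  "octonion_norm x = o0 (octonion_cnj x * x)"

lemma octonion_norm_left: "octonion_cnj x * x = octonion_norm x *\<^sub>R 1"
  and octonion_norm_right: "x * octonion_cnj x = octonion_norm x *\<^sub>R 1"
  and octonion_norm_sum_squares:
    "octonion_norm x = (o0 x)\<^sup>2 + (o1 x)\<^sup>2 + (o2 x)\<^sup>2 + (o3 x)\<^sup>2
                     + (o4 x)\<^sup>2 + (o5 x)\<^sup>2 + (o6 x)\<^sup>2 + (o7 x)\<^sup>2"
  by (simp_all add: octonion_eq_iff octonion_norm_def octonion_cnj_def times_octonion_def
       one_octonion_def scaleR_octonion_def power2_eq_square algebra_simps)

lemma octonion_norm_mult: "octonion_norm (x * y) = octonion_norm x * octonion_norm y"
  by (simp add: octonion_norm_sum_squares times_octonion_def power2_eq_square algebra_simps)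

lemma octonion_one_mult: "1 * x = x" "x * 1 = x" for x :: octonion
  by (simp_all add: octonion_eq_iff times_octonion_def one_octonion_def)

lemma octonion_basis_mult:
  "octonion_basis 0 = 1"
  "i \<in> {1..7} \<Longrightarrow> octonion_basis i * octonion_basis i = - 1"
  "(i, j, k) \<in> {(1, 2, 3), (1, 4, 5), (1, 7, 6), (2, 4, 6), (2, 5, 7), (3, 4, 7), (3, 6, 5)} \<Longrightarrow>
     octonion_basis i * octonion_basis j = octonion_basis k \<and>
     octonion_basis j * octonion_basis k = octonion_basis i \<and>
     octonion_basis k * octonion_basis i = octonion_basis j \<and>
     octonion_basis j * octonion_basis i = - octonion_basis k \<and>
     octonion_basis k * octonion_basis j = - octonion_basis i \<and>
     octonion_basis i * octonion_basis k = - octonion_basis j"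
proof -
  show "octonion_basis 0 = 1"
    by (simp add: octonion_basis_def one_octonion_def)
  show "octonion_basis i * octonion_basis i = - 1" if "i \<in> {1..7}"
  proof -
    have "i = 1 \<or> i = 2 \<or> i = 3 \<or> i = 4 \<or> i = 5 \<or> i = 6 \<or> i = 7"
      using that by (simp only: atLeastAtMost_iff) arith
    then show ?thesis
      by (elim disjE; simp only:)
        (simp_all add: octonion_basis_def times_octonion_def one_octonion_def uminus_octonion_def)
  qed
qed (simp only: insert_iff empty_iff prod.inject simp_thms, elim disjE conjE; simp only:;
     simp add: octonion_basis_def times_octonion_def uminus_octonion_def)

fun horadam :: "int \<Rightarrow> int \<Rightarrow> int \<Rightarrow> int \<Rightarrow> nat \<Rightarrow> int" where
  "horadam a b p q 0 = a"
| "horadam a b p q (Suc 0) = b"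
| "horadam a b p q (Suc (Suc n)) = p * horadam a b p q (Suc n) + q * horadam a b p q n"

definition horadam_octonion :: "int \<Rightarrow> int \<Rightarrow> int \<Rightarrow> int \<Rightarrow> nat \<Rightarrow> octonion" where
  "horadam_octonion a b p q n =
     (\<Sum>i = 0..7. real_of_int (horadam a b p q (n + i)) *\<^sub>R octonion_basis i)"

end

theory Submission
  imports Defs
begin

text \<open>Since \<alpha> and \<beta> are the roots of x^2 = p x + q, Binet's formula gives
  (\<alpha> - \<beta>) w_m = A \<alpha>^m - B \<beta>^m (\<open>horadam_binet\<close>). Squaring
  produces two pure powers and a cross term in which \<alpha>\<beta> = -q
  (\<open>horadam_square\<close>). The octonion norm is the sum of the squared coordinates w_n, ...,
  w_{n+7} (\<open>octonion_norm_horadam\<close>), so summing the squared formula over m = n, ...,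
  n+7 gives geometric-type sums; the cross terms add up to L.\<close>

text \<open>Both sides satisfy the same second-order recurrence and agree at 0 and 1. Keeping the
  factor \<alpha> - \<beta> on the left avoids division, so any commutative ring will do.\<close>

lemma horadam_binet:
  fixes \<alpha> \<beta> :: "'a::comm_ring_1"
  assumes sum: "\<alpha> + \<beta> = of_int p" and prod: "\<alpha> * \<beta> = - of_int q"
  shows "(\<alpha> - \<beta>) * of_int (horadam a b p q n) =
           (of_int b - of_int a * \<beta>) * \<alpha> ^ n - (of_int b - of_int a * \<alpha>) * \<beta> ^ n"
proof (induction n rule: induct_nat_012)
  case (ge2 n)
  let ?w = "\<lambda>n. of_int (horadam a b p q n) :: 'a"
  let ?A = "of_int b - of_int a * \<beta>" and ?B = "of_int b - of_int a * \<alpha>"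
  have q: "of_int q = - (\<alpha> * \<beta>)"
    using prod by simp
  \<comment> \<open>The recurrence with p and q replaced by symmetric functions of the roots,
    grouped so that both induction hypotheses apply as they stand.\<close>
  have "(\<alpha> - \<beta>) * ?w (Suc (Suc n)) =
          (\<alpha> + \<beta>) * ((\<alpha> - \<beta>) * ?w (Suc n)) - \<alpha> * \<beta> * ((\<alpha> - \<beta>) * ?w n)"
    by (simp add: q flip: sum) (simp add: algebra_simps)
  also have "\<dots> = ?A * \<alpha> ^ Suc (Suc n) - ?B * \<beta> ^ Suc (Suc n)"
    unfolding ge2.IH by (simp add: algebra_simps)
  finally show ?case .
qed (simp_all add: algebra_simps)

text \<open>The cross term pairs \<alpha>^n with \<beta>^n, and their product is a power of
  \<alpha>\<beta> = -q; this is the source of L.\<close>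

lemma horadam_square:
  fixes \<alpha> \<beta> :: "'a::comm_ring_1"
  assumes "\<alpha> + \<beta> = of_int p" and prod: "\<alpha> * \<beta> = - of_int q"
    and "A = of_int b - of_int a * \<beta>" and "B = of_int b - of_int a * \<alpha>"
  shows "(\<alpha> - \<beta>)\<^sup>2 * (of_int (horadam a b p q n))\<^sup>2 =
           A\<^sup>2 * \<alpha> ^ (2 * n) + B\<^sup>2 * \<beta> ^ (2 * n) - 2 * A * B * (- of_int q) ^ n"
proof -
  have "(\<alpha> - \<beta>)\<^sup>2 * (of_int (horadam a b p q n))\<^sup>2 = (A * \<alpha> ^ n - B * \<beta> ^ n)\<^sup>2"
    unfolding power_mult_distrib[symmetric] horadam_binet[OF assms(1,2)] assms(3,4) ..
  also have "\<dots> = A\<^sup>2 * (\<alpha> ^ n)\<^sup>2 + B\<^sup>2 * (\<beta> ^ n)\<^sup>2 - 2 * A * B * (\<alpha> ^ n * \<beta> ^ n)"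
    by (simp add: power2_diff power_mult_distrib mult_ac)
  also have "\<dots> = A\<^sup>2 * \<alpha> ^ (2 * n) + B\<^sup>2 * \<beta> ^ (2 * n) - 2 * A * B * (\<alpha> * \<beta>) ^ n"
    by (simp only: power_even_eq power_mult_distrib)
  finally show ?thesis
    unfolding prod .
qed

lemma sum_octonion:
  "sum f I = Octonion (\<Sum>i\<in>I. o0 (f i)) (\<Sum>i\<in>I. o1 (f i)) (\<Sum>i\<in>I. o2 (f i)) (\<Sum>i\<in>I. o3 (f i))
                      (\<Sum>i\<in>I. o4 (f i)) (\<Sum>i\<in>I. o5 (f i)) (\<Sum>i\<in>I. o6 (f i)) (\<Sum>i\<in>I. o7 (f i))"
  by (induction I rule: infinite_finite_induct) (simp_all add: zero_octonion_def plus_octonion_def)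

text \<open>The only point where octonions enter: distinct basis vectors occupy distinct
  coordinates, so \<open>octonion_norm_sum_squares\<close> applies directly.\<close>

lemma octonion_norm_horadam:
  "octonion_norm (horadam_octonion a b p q n) = (\<Sum>k = 0..7. (real_of_int (horadam a b p q (n + k)))\<^sup>2)"
proof -
  have interval: "{0..7} = {0, 1, 2, 3, 4, 5, 6, 7 :: nat}"
    by auto
  have "octonion_norm (\<Sum>i = 0..7. w i *\<^sub>R octonion_basis i) = (\<Sum>i = 0..7. (w i)\<^sup>2)" for w
  proof -
    have "(\<Sum>i = 0..7. w i *\<^sub>R octonion_basis i) =
            Octonion (w 0) (w 1) (w 2) (w 3) (w 4) (w 5) (w 6) (w 7)"
      by (simp add: sum_octonion scaleR_octonion_def octonion_basis_def of_bool_def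
          if_distrib[of "(*) _"] cong: if_cong)
    then show ?thesis
      unfolding interval by (simp add: octonion_norm_sum_squares)
  qed
  then show ?thesis
    unfolding horadam_octonion_def .
qed

theorem theorem3p5:
  fixes a b p q :: int and n :: nat and s \<alpha> \<beta> A B L :: complex
  assumes "p\<^sup>2 + 4 * q \<noteq> 0"
    and "s\<^sup>2 = of_int (p\<^sup>2 + 4 * q)"
    and "p\<^sup>2 + 4 * q > 0 \<Longrightarrow> s = complex_of_real (sqrt (real_of_int (p\<^sup>2 + 4 * q)))"
    and "\<alpha> = (of_int p + s) / 2"
    and "\<beta> = (of_int p - s) / 2"
    and "A = of_int b - of_int a * \<beta>"
    and "B = of_int b - of_int a * \<alpha>"
    and "L = 2 * A * B * (- of_int q) ^ n * (\<Sum>k = 0..7. (- of_int q) ^ k) / (\<alpha> - \<beta>)\<^sup>2"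
  shows "complex_of_real (octonion_norm (horadam_octonion a b p q n)) =
           (A\<^sup>2 * \<alpha> ^ (2 * n) * (\<Sum>k = 0..7. \<alpha> ^ (2 * k))
            + B\<^sup>2 * \<beta> ^ (2 * n) * (\<Sum>k = 0..7. \<beta> ^ (2 * k))) / (\<alpha> - \<beta>)\<^sup>2 - L"
proof -
  \<comment> \<open>A nonzero discriminant means distinct roots, since \<alpha> - \<beta> = s; this
    permits the final division.\<close>
  have "s \<noteq> 0"
    using assms(1,2) by (metis of_int_eq_0_iff zero_power2)
  moreover have "\<alpha> - \<beta> = s"
    unfolding assms(4,5) by (simp add: field_simps)
  ultimately have nz: "(\<alpha> - \<beta>)\<^sup>2 \<noteq> 0"
    by simp
  have sum: "\<alpha> + \<beta> = of_int p"
    unfolding assms(4,5) by (simp add: field_simps)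
  have "\<alpha> * \<beta> = ((of_int p)\<^sup>2 - s\<^sup>2) / 4"
    unfolding assms(4,5) by (simp add: power2_eq_square field_simps)
  then have prod: "\<alpha> * \<beta> = - of_int q"
    unfolding assms(2) by simp
  \<comment> \<open>Clearing the denominator turns each summand into an instance of
    \<open>horadam_square\<close> at index n + k.\<close>
  have "(\<alpha> - \<beta>)\<^sup>2 * complex_of_real (octonion_norm (horadam_octonion a b p q n)) =
          (\<Sum>k = 0..7. (\<alpha> - \<beta>)\<^sup>2 * (of_int (horadam a b p q (n + k)))\<^sup>2)"
    by (simp add: octonion_norm_horadam sum_distrib_left)
  also have "\<dots> = (\<Sum>k = 0..7. A\<^sup>2 * \<alpha> ^ (2 * n) * \<alpha> ^ (2 * k) + B\<^sup>2 * \<beta> ^ (2 * n) * \<beta> ^ (2 * k)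
                      - 2 * A * B * (- of_int q) ^ n * (- of_int q) ^ k)"
    \<comment> \<open>Splitting the exponents of index n + k separates the factors depending on n,
      which then leave the sums.\<close>
    unfolding horadam_square[OF sum prod assms(6,7)] by (simp only: distrib_left power_add mult.assoc)
  also have "\<dots> = A\<^sup>2 * \<alpha> ^ (2 * n) * (\<Sum>k = 0..7. \<alpha> ^ (2 * k))
                    + B\<^sup>2 * \<beta> ^ (2 * n) * (\<Sum>k = 0..7. \<beta> ^ (2 * k))
                    - 2 * A * B * (- of_int q) ^ n * (\<Sum>k = 0..7. (- of_int q) ^ k)"
    by (simp only: sum.distrib sum_subtractf sum_distrib_left)
  finally show ?thesis
    unfolding assms(8) diff_divide_distrib[symmetric]
    by (subst nonzero_eq_divide_eq[OF nz]) (simp only: mult.commute)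
qed

end
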